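(* For every fixed integer $k\ge 2$, we have $e_k(n) = n\cdot\left\lceil\frac{k}{2}\right\rceil -o(n)$ as $n \to \infty$. Moreover, for every fixed integer $k\geq 3$, we have $$n\cdot\left\lceil\frac{k}{2}\right\rceil-O\left(k^2\cdot\sqrt{n}\right) \le e_k(n) \le n\cdot\left\lceil\frac{k}{2}\right\rceil -\Omega\left(k\cdot\sqrt{n}\right)$$ as $n\to\infty$, where the constants implied by the $O$ and $\Omega$ notation are positive and absolute (independent of $k$ and $n$).
   Context: Let $k\ge 1$ be an integer. For a point $p\in\mathbb{R}^2$ and $i=0,\dots,k-1$, let $\ell_i(p)$ be the ray from $p$ in direction $(\cos(2\pi i/k),\sin(2\pi i/k))$. These $k$ rays (the sector-bounding rays of $p$) divide the plane around $p$ into $k$ equal sectors $s_0(p),\dots,s_{k-1}(p)$, where $s_i(p)$ is the sector bounded by $\ell_i(p)$ and the next ray $\ell_{i+1}(p)$ counterclockwise (indices mod $k$). All point sets are finite and in general position (with respect to $k$): no point of the set lies on a sector-bounding ray of another point of the set, and there are no three distinct points $p,q,q'$ in the set such that $q,q'$ lie in the same sector of $p$ and are at the same Euclidean distance from $p$. Given a point set $P$ and a linear order $p_1,\dots,p_n$ of $P$, the corresponding $k$-sector ordered Yao graph is the directed graph on $P$ in which, for every $j$ and every $i$ such that the sector $s_i(p_j)$ contains at least one of the predecessors $p_1,\dots,p_{j-1}$, there is exactly one edge from $p_j$ to its closest (in Euclidean distance) predecessor in $s_i(p_j)$; there are no other edges. $e_k(n)$ is the maximum integer for which there exists an $n$-point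 set in the plane such that for every order, the corresponding $k$-sector ordered Yao graph contains at least $e_k(n)$ edges. *)

theory Defs
  imports Complex_Main "HOL-Library.Landau_Symbols"
begin

text \<open>
  The Euclidean plane is represented by the type \<^typ>\<open>complex\<close>; its \<^const>\<open>dist\<close> is the
  Euclidean distance and \<open>cis \<theta>\<close> is the vector \<open>(cos \<theta>, sin \<theta>)\<close>.
\<close>

definition bounding_ray :: "nat \<Rightarrow> nat \<Rightarrow> complex \<Rightarrow> complex set" where
  "bounding_ray k i p = {p + of_real t * cis (2 * pi * real i / real k) | t. t \<ge> 0}"

text \<open>
  Sectors are taken to be open and without the apex. For points in general position (below)
  including the boundary would make no difference, since no other point lies on a bounding ray.
\<close>

definition sector :: "nat \<Rightarrow> nat \<Rightarrow> complex \<Rightarrow> complex set" where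
  "sector k i p = {p + of_real r * cis \<theta> | r \<theta>.
     r > 0 \<and> 2 * pi * real i / real k < \<theta> \<and> \<theta> < 2 * pi * real (i + 1) / real k}"

definition general_position :: "nat \<Rightarrow> complex set \<Rightarrow> bool" where
  "general_position k P \<longleftrightarrow>
     (\<forall>p\<in>P. \<forall>q\<in>P. p \<noteq> q \<longrightarrow> (\<forall>i<k. q \<notin> bounding_ray k i p)) \<and>
     \<not> (\<exists>p\<in>P. \<exists>q\<in>P. \<exists>q'\<in>P. p \<noteq> q \<and> p \<noteq> q' \<and> q \<noteq> q' \<and>
          (\<exists>i<k. q \<in> sector k i p \<and> q' \<in> sector k i p) \<and> dist p q = dist p q')"

text \<open>
  A linear order of a finite point set is a repetition-free list of its points; \<open>take j ps\<close>
  consists of the predecessors of \<open>ps ! j\<close>. In general position the closest predecessor in a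
  sector is unique, so each sector containing a predecessor contributes exactly one edge.
\<close>

definition ordered_yao_edges :: "nat \<Rightarrow> complex list \<Rightarrow> (complex \<times> complex) set" where
  "ordered_yao_edges k ps =
     {(ps ! j, q) | j q. j < length ps \<and>
        (\<exists>i<k. is_arg_min (dist (ps ! j)) (\<lambda>x. x \<in> set (take j ps) \<inter> sector k i (ps ! j)) q)}"

definition orders_of :: "'a set \<Rightarrow> 'a list set" where
  "orders_of P = {ps. distinct ps \<and> set ps = P}"

definition yao_e :: "nat \<Rightarrow> nat \<Rightarrow> nat" where
  "yao_e k n = (GREATEST m. \<exists>P. finite P \<and> card P = n \<and> general_position k P \<and>
     (\<forall>ps \<in> orders_of P. m \<le> card (ordered_yao_edges k ps)))"

end

theory Submission
  imports Defs "HOL-Analysis.Analysis" "HOL-Real_Asymp.Real_Asymp"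
begin

text \<open>
  By general position an ordered Yao graph has exactly one edge for each pair of a point \<open>p\<close> and
  a sector of \<open>p\<close> that contains a predecessor of \<open>p\<close>; such a sector is called seen below. So
  distances become irrelevant, and \<open>e\<^sub>k(n)\<close> asks how many seen sectors an adversarial
  order must leave (\<open>card_ordered_yao_edges\<close>). Write \<open>h = \<lceil>k/2\<rceil>\<close>.

  Upper bound. If the points are added by sweeping a line parallel to a sector-bounding ray, all
  predecessors of a point lie in an open half plane that meets only \<open>h\<close> sectors, so \<open>n h\<close> edges
  suffice. To save more, take two such lines, parallel to the rays \<open>0\<close> and \<open>r = \<lfloor>h/2\<rfloor>\<close>, and
  use the two signed distances as skew coordinates. A growing box alternates between the two
  sweeps, and a point that is extreme in both coordinates when it is added sees only the sectors of a
  wedge between the lines, which are \<open>r\<close> or \<open>h - r\<close> in number. The box can be steered so that this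
  happens at every point of any chosen monotone chain (\<open>exists_box_growing_order\<close>), and by Erdos and
  Szekeres some increasing or decreasing chain has at least \<open>\<surd>n\<close> points
  (\<open>erdos_szekeres\<close>). Each saves at least \<open>r\<close> edges, which is of order \<open>k\<close> once \<open>k \<ge> 3\<close>.

  Lower bound. Consider a regular \<open>k\<close>-gon rotated so that the bisector of sector \<open>m\<close> at vertex
  \<open>m\<close> points to the centre. Put \<open>d = \<lfloor>k/2\<rfloor>\<close>. Vertex \<open>m + d\<close> is (almost) antipodal to vertex \<open>m\<close>,
  it lies in sector \<open>m\<close> of vertex \<open>m\<close>, and vertex \<open>m\<close> lies in sector \<open>m + d\<close> of vertex
  \<open>m + d\<close>. Whichever comes later sees the other in the sector facing the centre, so the set \<open>X\<close>
  of vertices that do not see their facing sector is disjoint from its shift \<open>X + d\<close>. Therefore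
  \<open>2 |X| \<le> k\<close>, and at least \<open>h\<close> vertices see their facing sector (\<open>card_seen_polygon\<close>).
  If the circumradius is a suitable multiple of \<open>k\<close>, these incidences survive moving every vertex by a
  bounded amount. So the vertices can be rounded to points of a square grid that has been perturbed
  into general position (\<open>exists_general_position_perturbation\<close>). For a fixed \<open>m\<close> the rounded vertices
  of translated polygons are translates of each other, so different centres yield different
  pairs of a point and a sector. A grid of side \<open>\<surd>n\<close> has room for all but \<open>O(k \<surd>n)\<close> of the
  centres, and each contributes \<open>h\<close> edges (\<open>exists_point_set_many_edges\<close>).

  Both estimates hold for every \<open>n\<close> and for \<open>k = 2\<close> as well, where \<open>r = 0\<close> and the upper bound
  has no square-root term; this is enough for the asymptotic claim.
\<close>

section \<open>Edges as seen sectors\<close>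

definition precedes :: "'a list \<Rightarrow> 'a \<Rightarrow> 'a \<Rightarrow> bool" where
  "precedes ps q p \<longleftrightarrow> (\<exists>j<length ps. ps ! j = p \<and> q \<in> set (take j ps))"

definition seen_sectors :: "nat \<Rightarrow> complex list \<Rightarrow> complex \<Rightarrow> nat set" where
  "seen_sectors k ps p = {i. i < k \<and> (\<exists>q \<in> sector k i p. precedes ps q p)}"

lemma precedes_in_set: "precedes ps q p \<Longrightarrow> q \<in> set ps"
  unfolding precedes_def by (auto dest: in_set_takeD)

lemma precedes_in_set2: "precedes ps q p \<Longrightarrow> p \<in> set ps"
  unfolding precedes_def by auto

lemma precedes_snoc: "precedes (ps @ [a]) q p \<longleftrightarrow> precedes ps q p \<or> p = a \<and> q \<in> set ps"
proof -
  have "precedes (ps @ [a]) q p \<longleftrightarrow> (\<exists>j<Suc (length ps). (ps @ [a]) ! j = p \<and> q \<in> set (take j (ps @ [a])))"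
    by (simp add: precedes_def)
  also have "\<dots> \<longleftrightarrow> a = p \<and> q \<in> set ps \<or> (\<exists>j<length ps. (ps @ [a]) ! j = p \<and> q \<in> set (take j (ps @ [a])))"
    by (simp only: less_Suc_eq ex_disj_distrib conj_disj_distribR simp_thms nth_append_length) (simp add: disj_commute)
  also have "(\<exists>j<length ps. (ps @ [a]) ! j = p \<and> q \<in> set (take j (ps @ [a]))) \<longleftrightarrow> precedes ps q p"
    unfolding precedes_def by (intro ex_cong1 conj_cong refl) (simp_all add: nth_append take_append)
  finally show ?thesis by metis
qed

lemma precedes_total:
  assumes "p \<in> set ps" "q \<in> set ps" "p \<noteq> q"
  shows "precedes ps p q \<or> precedes ps q p"
proof -
  obtain i j where ij: "i < length ps" "ps ! i = p" "j < length ps" "ps ! j = q"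
    using assms by (metis in_set_conv_nth)
  show ?thesis
  proof (cases "i < j")
    case True
    then have "p \<in> set (take j ps)" using ij by (metis in_set_conv_nth length_take min.absorb4 nth_take)
    then show ?thesis unfolding precedes_def using ij by auto
  next
    case False
    then have "j < i" using ij assms by (metis linorder_neqE_nat)
    then have "q \<in> set (take i ps)" using ij by (metis in_set_conv_nth length_take min.absorb4 nth_take)
    then show ?thesis unfolding precedes_def using ij by auto
  qed
qed

text \<open>
  Measuring angles in \<open>[0, 2\<pi>)\<close> identifies the sector index with the position of a single number
  among the multiples of \<open>2\<pi>/k\<close>, which makes disjointness of the sectors immediate.
\<close>

lemma sector_iff_Arg2pi:
  assumes "i < k"
  shows "q \<in> sector k i p \<longleftrightarrow> q \<noteq> p \<and> 2 * pi * real i / real k < Arg2pi (q - p) \<and>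
           Arg2pi (q - p) < 2 * pi * real (i + 1) / real k"
proof
  assume "q \<in> sector k i p"
  then obtain r \<theta> where q: "q = p + of_real r * cis \<theta>" and r: "r > 0"
    and t: "2 * pi * real i / real k < \<theta>" "\<theta> < 2 * pi * real (i + 1) / real k"
    unfolding sector_def by auto
  have "0 \<le> 2 * pi * real i / real k" by simp
  moreover have "2 * pi * real (i + 1) / real k \<le> 2 * pi"
    using assms by (simp add: divide_simps)
  ultimately have "0 \<le> \<theta>" "\<theta> < 2 * pi" using t by linarith+
  then have "Arg2pi (q - p) = \<theta>"
    by (intro Arg2pi_unique[of r]) (use q r in \<open>auto simp: cis_conv_exp\<close>)
  then show "q \<noteq> p \<and> 2 * pi * real i / real k < Arg2pi (q - p) \<and>
           Arg2pi (q - p) < 2 * pi * real (i + 1) / real k" using q r t by auto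
next
  assume R: "q \<noteq> p \<and> 2 * pi * real i / real k < Arg2pi (q - p) \<and>
           Arg2pi (q - p) < 2 * pi * real (i + 1) / real k"
  have "q = p + of_real (norm (q - p)) * cis (Arg2pi (q - p))"
    using Arg2pi_eq[of "q - p"] by (simp add: cis_conv_exp mult.commute)
  then show "q \<in> sector k i p" using R unfolding sector_def
    by (intro CollectI exI[of _ "norm (q-p)"] exI[of _ "Arg2pi (q-p)"]) auto
qed

lemma sector_disjoint:
  assumes "i < k" "j < k" "q \<in> sector k i p" "q \<in> sector k j p"
  shows "i = j"
proof -
  have *: "\<not> i < j" if "i < k" "j < k" "q \<in> sector k i p" "q \<in> sector k j p" for i j
  proof
    assume "i < j"
    then have "real (i + 1) \<le> real j" by simp
    then have "2 * pi * real (i + 1) / real k \<le> 2 * pi * real j / real k"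
      by (intro divide_right_mono mult_left_mono) auto
    then show False using that by (auto simp: sector_iff_Arg2pi)
  qed
  show ?thesis using *[of i j] *[of j i] assms by linarith
qed

lemma general_position_dist_neq:
  assumes "general_position k P" "p \<in> P" "q \<in> P" "q' \<in> P" "p \<noteq> q" "p \<noteq> q'" "q \<noteq> q'"
    "i < k" "q \<in> sector k i p" "q' \<in> sector k i p"
  shows "dist p q \<noteq> dist p q'"
proof
  assume "dist p q = dist p q'"
  with assms(2-) have "\<exists>p\<in>P. \<exists>q\<in>P. \<exists>q'\<in>P. p \<noteq> q \<and> p \<noteq> q' \<and> q \<noteq> q' \<and>
    (\<exists>i<k. q \<in> sector k i p \<and> q' \<in> sector k i p) \<and> dist p q = dist p q'"
    by (intro bexI[of _ p] bexI[of _ q] bexI[of _ q'] conjI exI[of _ i]) auto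
  then show False using assms(1) unfolding general_position_def by argo
qed

text \<open>
  The edge for a seen sector goes to the nearest predecessor in it. General position makes that
  predecessor unique, and since the sectors of a point are disjoint, different sectors give
  different edges.
\<close>

lemma card_ordered_yao_edges:
  assumes d: "distinct ps" and gp: "general_position k (set ps)"
  shows "card (ordered_yao_edges k ps) = (\<Sum>p\<in>set ps. card (seen_sectors k ps p))"
proof -
  define N where "N p i q \<longleftrightarrow> is_arg_min (dist p) (\<lambda>x. precedes ps x p \<and> x \<in> sector k i p) q" for p i q
  have ND: "precedes ps q p" "q \<in> sector k i p" "\<And>x. precedes ps x p \<Longrightarrow> x \<in> sector k i p \<Longrightarrow> dist p q \<le> dist p x"
    if "N p i q" for p i q
    using that by (auto simp: N_def is_arg_min_linorder)
  have pre: "precedes ps x (ps ! j) \<longleftrightarrow> x \<in> set (take j ps)" if "j < length ps" for x j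
    unfolding precedes_def using that d by (metis nth_eq_iff_index_eq)
  have E: "ordered_yao_edges k ps = {(p, q). p \<in> set ps \<and> (\<exists>i<k. N p i q)}"
  proof -
    have "ordered_yao_edges k ps = {(ps ! j, q) | j q. j < length ps \<and> (\<exists>i<k. N (ps ! j) i q)}"
      unfolding ordered_yao_edges_def
      by (intro Collect_cong ex_cong1 conj_cong refl) (simp add: is_arg_min_def pre N_def)
    also have "\<dots> = {(p, q). p \<in> set ps \<and> (\<exists>i<k. N p i q)}"
      unfolding in_set_conv_nth by blast
    finally show ?thesis .
  qed
  have ex: "\<exists>q. N p i q" if "i \<in> seen_sectors k ps p" for p i
  proof -
    have "finite {x. precedes ps x p \<and> x \<in> sector k i p}"
      by (rule finite_subset[of _ "set ps"]) (auto dest: precedes_in_set)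
    moreover have "{x. precedes ps x p \<and> x \<in> sector k i p} \<noteq> {}"
      using that by (auto simp: seen_sectors_def)
    ultimately show ?thesis
      using ex_is_arg_min_if_finite[of "{x. precedes ps x p \<and> x \<in> sector k i p}" "dist p"] by (auto simp: N_def)
  qed
  define nearest where "nearest p i = (SOME q. N p i q)" for p i
  have near: "N p i (nearest p i)" if "i \<in> seen_sectors k ps p" for p i
    unfolding nearest_def using someI_ex[OF ex[OF that]] .
  define f where "f = (\<lambda>(p, i). (p, nearest p i))"
  let ?S = "Sigma (set ps) (seen_sectors k ps)"
  have uniq: "q = q'" if "p \<in> set ps" "i < k" "N p i q" "N p i q'" for p i q q'
  proof (rule ccontr)
    assume "q \<noteq> q'"
    have a: "q \<in> sector k i p" "q' \<in> sector k i p" "q \<in> set ps" "q' \<in> set ps"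
      by (fact ND(2)[OF that(3)] ND(2)[OF that(4)] precedes_in_set[OF ND(1)[OF that(3)]]
            precedes_in_set[OF ND(1)[OF that(4)]])+
    moreover have "dist p q = dist p q'"
      using ND(3)[OF that(3) ND(1,2)[OF that(4)]] ND(3)[OF that(4) ND(1,2)[OF that(3)]] by simp
    moreover have "p \<noteq> q" "p \<noteq> q'" using a(1,2) sector_iff_Arg2pi[OF that(2)] by blast+
    ultimately show False
      using general_position_dist_neq[OF gp that(1) a(3,4) _ _ \<open>q \<noteq> q'\<close> that(2) a(1,2)] by simp
  qed
  have "bij_betw f ?S (ordered_yao_edges k ps)"
  proof (rule bij_betw_imageI)
    show "inj_on f ?S"
    proof (rule inj_onI)
      fix x y assume xy: "x \<in> ?S" "y \<in> ?S" "f x = f y"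
      obtain p i p' i' where s: "x = (p, i)" "y = (p', i')" by (cases x, cases y) auto
      then have mem: "i \<in> seen_sectors k ps p" "i' \<in> seen_sectors k ps p'" using xy by auto
      have pp: "p = p'" and qq: "nearest p i = nearest p' i'"
        using xy s by (auto simp: f_def)
      have "nearest p i \<in> sector k i p" "nearest p' i' \<in> sector k i' p'"
        using near[OF mem(1)] near[OF mem(2)] by (simp_all add: ND)
      then have "i = i'" using pp qq mem sector_disjoint[of i k i'] by (auto simp: seen_sectors_def)
      then show "x = y" using pp s by simp
    qed
    show "f ` ?S = ordered_yao_edges k ps"
    proof
      show "f ` ?S \<subseteq> ordered_yao_edges k ps"
      proof (clarsimp simp: E f_def)
        fix p i assume "i \<in> seen_sectors k ps p"
        then show "\<exists>j<k. N p j (nearest p i)" using near by (auto simp: seen_sectors_def)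
      qed
      show "ordered_yao_edges k ps \<subseteq> f ` ?S"
      proof (clarsimp simp: E)
        fix p q i assume a: "p \<in> set ps" "i < k" "N p i q"
        then have m: "i \<in> seen_sectors k ps p" using ND(1,2)[OF a(3)] by (auto simp: seen_sectors_def)
        have "q = nearest p i" using uniq[OF a near[OF m]] .
        then have "(p, q) = f (p, i)" by (simp add: f_def)
        then show "(p, q) \<in> f ` ?S" using a m by blast
      qed
    qed
  qed
  then have "card (ordered_yao_edges k ps) = card ?S" by (simp add: bij_betw_same_card)
  also have "\<dots> = (\<Sum>p\<in>set ps. card (seen_sectors k ps p))"
    by (subst card_SigmaI) (auto simp: seen_sectors_def)
  finally show ?thesis .
qed

section \<open>Monotone chains and box-growing orders\<close>

definition increasing_on :: "'a set \<Rightarrow> ('a \<Rightarrow> real) \<Rightarrow> ('a \<Rightarrow> real) \<Rightarrow> bool" where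
  "increasing_on A u v \<longleftrightarrow> (\<forall>a\<in>A. \<forall>b\<in>A. u a < u b \<longrightarrow> v a < v b)"

lemma finite_has_max_card:
  assumes "finite \<A>" "\<A> \<noteq> {}"
  obtains A where "A \<in> \<A>" "\<And>B. B \<in> \<A> \<Longrightarrow> card B \<le> card A"
proof -
  have "Max (card ` \<A>) \<in> card ` \<A>" using assms by simp
  then obtain A where A: "A \<in> \<A>" "Max (card ` \<A>) = card A" by auto
  moreover have "card B \<le> card A" if "B \<in> \<A>" for B
    using that assms A(2) Max_ge[of "card ` \<A>" "card B"] by auto
  ultimately show thesis using that by blast
qed

text \<open>
  Rank each point by the size of the largest increasing chain that ends in it. Two points with
  \<open>u p < u q\<close> and \<open>v p < v q\<close> have different ranks, because \<open>q\<close> extends every chain ending in \<open>p\<close>.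
  So the points of one rank form a decreasing chain, and \<open>P\<close> has at most as many
  points as the product of the two maximal chain sizes.
\<close>

lemma erdos_szekeres:
  fixes u v :: "'a \<Rightarrow> real"
  assumes fin: "finite P" and iu: "inj_on u P" and iv: "inj_on v P"
  obtains A where "A \<subseteq> P" "card P \<le> (card A)\<^sup>2"
    "increasing_on A u v \<or> increasing_on A u (\<lambda>x. - v x)"
proof -
  have "finite {A. A \<subseteq> P \<and> increasing_on A u v}" using fin by simp
  moreover have "{} \<in> {A. A \<subseteq> P \<and> increasing_on A u v}" by (simp add: increasing_on_def)
  ultimately obtain A where A: "A \<subseteq> P" "increasing_on A u v"
    and maxA: "\<And>B. B \<subseteq> P \<Longrightarrow> increasing_on B u v \<Longrightarrow> card B \<le> card A"
    using finite_has_max_card[of "{A. A \<subseteq> P \<and> increasing_on A u v}"] by (metis (mono_tags, lifting) empty_iff mem_Collect_eq)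
  have "finite {A. A \<subseteq> P \<and> increasing_on A u (\<lambda>x. - v x)}" using fin by simp
  moreover have "{} \<in> {A. A \<subseteq> P \<and> increasing_on A u (\<lambda>x. - v x)}" by (simp add: increasing_on_def)
  ultimately obtain D where D: "D \<subseteq> P" "increasing_on D u (\<lambda>x. - v x)"
    and maxD: "\<And>B. B \<subseteq> P \<Longrightarrow> increasing_on B u (\<lambda>x. - v x) \<Longrightarrow> card B \<le> card D"
    using finite_has_max_card[of "{A. A \<subseteq> P \<and> increasing_on A u (\<lambda>x. - v x)}"] by (metis (mono_tags, lifting) empty_iff mem_Collect_eq)
  define chains where "chains p = {B. B \<subseteq> P \<and> increasing_on B u v \<and> p \<in> B \<and> (\<forall>b\<in>B. u b \<le> u p)}" for p
  have finc: "finite (chains p)" for p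
    by (rule finite_subset[of _ "Pow P"]) (use fin in \<open>auto simp: chains_def\<close>)
  define rank where "rank p = Max (card ` chains p)" for p
  have rank_ex: "\<exists>B\<in>chains p. card B = rank p" if "p \<in> P" for p
  proof -
    have "{p} \<in> chains p" using that by (auto simp: chains_def increasing_on_def)
    then have "rank p \<in> card ` chains p" unfolding rank_def using finc by (intro Max_in) auto
    then show ?thesis by auto
  qed
  have rank_le: "rank p \<le> card A" if "p \<in> P" for p
  proof -
    obtain B where "B \<in> chains p" "card B = rank p" using rank_ex \<open>p \<in> P\<close> by blast
    then show ?thesis using maxA[of B] by (simp add: chains_def)
  qed
  have rank_less: "rank p < rank q" if pq: "p \<in> P" "q \<in> P" "u p < u q" "v p < v q" for p q
  proof -
    obtain B where B: "B \<in> chains p" "card B = rank p" using rank_ex pq by blast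
    have "v b < v q" if "b \<in> B" for b
    proof -
      have b: "b \<in> P" "u b \<le> u p" "u b < u p \<Longrightarrow> v b < v p"
        using B(1) that by (auto simp: chains_def increasing_on_def)
      show ?thesis
      proof (cases "u b = u p")
        case True
        then have "b = p" using b(1) pq(1) iu by (simp add: inj_onD)
        then show ?thesis using pq(4) by simp
      next
        case False
        then show ?thesis using b pq(4) by linarith
      qed
    qed
    moreover have "u b < u q" if "b \<in> B" for b
      using B(1) that pq(3) by (force simp: chains_def)
    ultimately have "increasing_on (insert q B) u v" "\<forall>b\<in>insert q B. u b \<le> u q"
      using B(1) unfolding chains_def increasing_on_def by (auto dest: order.asym less_imp_le)
    then have "insert q B \<in> chains q" using B(1) pq(2) by (simp add: chains_def)
    then have "card (insert q B) \<le> rank q" unfolding rank_def using finc by simp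
    moreover have "q \<notin> B" "finite B" using B pq fin by (auto simp: chains_def intro: finite_subset)
    ultimately show ?thesis using B by simp
  qed
  have level: "card {p \<in> P. rank p = l} \<le> card D" for l
  proof (rule maxD)
    show "increasing_on {p \<in> P. rank p = l} u (\<lambda>x. - v x)"
      unfolding increasing_on_def
    proof (intro ballI impI)
      fix a b assume ab: "a \<in> {p \<in> P. rank p = l}" "b \<in> {p \<in> P. rank p = l}" "u a < u b"
      then have "\<not> v a < v b" using rank_less[of a b] by auto
      moreover have "v a \<noteq> v b" using ab iv by (auto dest: inj_onD)
      ultimately show "- v a < - v b" by simp
    qed
  qed auto
  have pos: "rank p \<noteq> 0" if "p \<in> P" for p
  proof -
    obtain B where "B \<in> chains p" "card B = rank p" using rank_ex \<open>p \<in> P\<close> by blast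
    moreover from this have "finite B" "p \<in> B" using fin by (auto simp: chains_def intro: finite_subset)
    ultimately show ?thesis by (metis card_0_eq empty_iff)
  qed
  have "rank p \<in> {1..card A}" if "p \<in> P" for p
    using rank_le[OF that] pos[OF that] by (simp add: Suc_le_eq)
  then have "P \<subseteq> (\<Union>l\<in>{1..card A}. {p \<in> P. rank p = l})" by blast
  then have "card P \<le> card (\<Union>l\<in>{1..card A}. {p \<in> P. rank p = l})"
    by (rule card_mono[rotated]) (use fin in simp)
  also have "\<dots> \<le> (\<Sum>l\<in>{1..card A}. card {p \<in> P. rank p = l})"
    by (rule card_UN_le) simp
  also have "\<dots> \<le> (\<Sum>l\<in>{1..card A}. card D)" by (intro sum_mono level)
  also have "\<dots> = card A * card D" by simp
  finally have prod: "card P \<le> card A * card D" .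
  show thesis
  proof (cases "card D \<le> card A")
    case True
    then have "card A * card D \<le> (card A)\<^sup>2" by (simp add: power2_eq_square)
    then show thesis using that[of A] A prod by simp
  next
    case False
    then have "card A * card D \<le> (card D)\<^sup>2" by (simp add: power2_eq_square)
    then show thesis using that[of D] D prod by simp
  qed
qed

text \<open>
  The order is built from its end. As long as the point with the largest \<open>u\<close> or the point with the
  largest \<open>v\<close> lies outside the chain \<open>A\<close>, that point may come last. Otherwise both lie in \<open>A\<close>, and
  since \<open>A\<close> is increasing they are the same point, which therefore exceeds all others in both
  coordinates.
\<close>

lemma exists_box_growing_order:
  fixes u v :: "'a \<Rightarrow> real"
  assumes "finite P" "inj_on u P" "inj_on v P" "A \<subseteq> P" "increasing_on A u v"
  shows "\<exists>ps\<in>orders_of P. \<forall>p\<in>P.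
    ((\<forall>q. precedes ps q p \<longrightarrow> u q < u p) \<or> (\<forall>q. precedes ps q p \<longrightarrow> v q < v p)) \<and>
    (p \<in> A \<longrightarrow> (\<forall>q. precedes ps q p \<longrightarrow> u q < u p \<and> v q < v p))"
  using assms
proof (induction "card P" arbitrary: P A)
  case 0
  then show ?case by (auto simp: orders_of_def)
next
  case (Suc n)
  have ne: "P \<noteq> {}" using Suc.hyps(2) by auto
  have max: "\<exists>a\<in>P. \<forall>q\<in>P - {a}. w q < w a" if "inj_on w P" for w :: "'a \<Rightarrow> real"
  proof -
    have "Max (w ` P) \<in> w ` P" using Suc.prems(1) ne by simp
    then obtain a where a: "a \<in> P" "w a = Max (w ` P)" by auto
    have "w q < w a" if "q \<in> P - {a}" for q
    proof -
      have "w q \<le> w a" using a Suc.prems(1) that by simp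
      moreover have "w q \<noteq> w a" using a(1) that inj_onD[OF \<open>inj_on w P\<close>, of q a] by blast
      ultimately show ?thesis by simp
    qed
    then show ?thesis using a by blast
  qed
  obtain x where x: "x \<in> P" "\<And>q. q \<in> P - {x} \<Longrightarrow> u q < u x" using max[OF Suc.prems(2)] by blast
  obtain y where y: "y \<in> P" "\<And>q. q \<in> P - {y} \<Longrightarrow> v q < v y" using max[OF Suc.prems(3)] by blast
  have "x = y" if "x \<in> A" "y \<in> A"
  proof (rule ccontr)
    assume "x \<noteq> y"
    then have "u y < u x" "v x < v y" using x y by auto
    then show False using Suc.prems(5) that unfolding increasing_on_def by fastforce
  qed
  then have "\<exists>a\<in>P. ((\<forall>q\<in>P - {a}. u q < u a) \<or> (\<forall>q\<in>P - {a}. v q < v a)) \<and>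
      (a \<in> A \<longrightarrow> (\<forall>q\<in>P - {a}. u q < u a \<and> v q < v a))"
    using x y by metis
  then obtain a where a: "a \<in> P" "(\<forall>q\<in>P - {a}. u q < u a) \<or> (\<forall>q\<in>P - {a}. v q < v a)"
    "a \<in> A \<Longrightarrow> \<forall>q\<in>P - {a}. u q < u a \<and> v q < v a" by blast
  have "n = card (P - {a})" using Suc a by simp
  moreover have "inj_on u (P - {a})" "inj_on v (P - {a})" using Suc.prems by (auto intro: inj_on_diff)
  moreover have "increasing_on (A - {a}) u v" using Suc.prems(5) by (auto simp: increasing_on_def)
  ultimately obtain ps where ps: "ps \<in> orders_of (P - {a})"
    "\<And>p. p \<in> P - {a} \<Longrightarrow>
      ((\<forall>q. precedes ps q p \<longrightarrow> u q < u p) \<or> (\<forall>q. precedes ps q p \<longrightarrow> v q < v p)) \<and>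
      (p \<in> A - {a} \<longrightarrow> (\<forall>q. precedes ps q p \<longrightarrow> u q < u p \<and> v q < v p))"
    using Suc.hyps(1)[of "P - {a}" "A - {a}"] Suc.prems by (metis Diff_mono finite_Diff subset_refl)
  have st: "distinct ps" "set ps = P - {a}" using ps by (auto simp: orders_of_def)
  have "ps @ [a] \<in> orders_of P" using st a by (auto simp: orders_of_def)
  moreover have last: "precedes (ps @ [a]) q a \<longleftrightarrow> q \<in> P - {a}" for q
    using st precedes_in_set2[of ps q a] by (auto simp: precedes_snoc)
  moreover have old: "precedes (ps @ [a]) q p \<longleftrightarrow> precedes ps q p" if "p \<noteq> a" for p q
    using that by (auto simp: precedes_snoc)
  moreover have "((\<forall>q. precedes (ps @ [a]) q p \<longrightarrow> u q < u p) \<or> (\<forall>q. precedes (ps @ [a]) q p \<longrightarrow> v q < v p)) \<and>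
    (p \<in> A \<longrightarrow> (\<forall>q. precedes (ps @ [a]) q p \<longrightarrow> u q < u p \<and> v q < v p))" if "p \<in> P" for p
  proof (cases "p = a")
    case True
    then show ?thesis using a unfolding True last by blast
  next
    case False
    then show ?thesis using ps(2)[of p] that by (simp add: old)
  qed
  ultimately show ?case by blast
qed

section \<open>Orders with few edges\<close>

text \<open>
  Up to sign this is the distance of \<open>p\<close> from the line through the origin in the direction of ray
  \<open>r\<close>; it is positive to the left of that line.
\<close>

definition offset :: "nat \<Rightarrow> nat \<Rightarrow> complex \<Rightarrow> real" where
  "offset k r p = Im (p * cis (- (2 * pi * real r / real k)))"

lemma sector_offset:
  assumes "q \<in> sector k i p"
  obtains \<rho> \<theta> where "\<rho> > 0" "2 * pi * real i / real k < \<theta>" "\<theta> < 2 * pi * real (i + 1) / real k"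
    "\<And>r. offset k r q - offset k r p = \<rho> * sin (\<theta> - 2 * pi * real r / real k)"
proof -
  obtain \<rho> \<theta> where q: "q = p + of_real \<rho> * cis \<theta>" and r: "\<rho> > 0"
    and t: "2 * pi * real i / real k < \<theta>" "\<theta> < 2 * pi * real (i + 1) / real k"
    using assms unfolding sector_def by auto
  have "offset k r q - offset k r p = \<rho> * sin (\<theta> - 2 * pi * real r / real k)" for r
    by (simp add: offset_def q algebra_simps sin_diff)
  then show thesis using that r t by blast
qed

text \<open>
  A sector whose angles exceed that of ray \<open>r\<close> by at most \<open>\<pi>\<close> lies to the left of the line
  through the apex parallel to ray \<open>r\<close>.
\<close>

lemma offset_less_sector:
  assumes "q \<in> sector k i p" "r \<le> i" "2 * (i + 1 - r) \<le> k"
  shows "offset k r p < offset k r q"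
proof -
  obtain \<rho> \<theta> where \<rho>: "\<rho> > 0" and t: "2 * pi * real i / real k < \<theta>" "\<theta> < 2 * pi * real (i + 1) / real k"
    and o: "\<And>r. offset k r q - offset k r p = \<rho> * sin (\<theta> - 2 * pi * real r / real k)"
    using sector_offset[OF assms(1)] by metis
  have k: "real k > 0" using assms by simp
  have "2 * pi * real r / real k \<le> 2 * pi * real i / real k"
    using assms by (intro divide_right_mono mult_left_mono) auto
  moreover have "2 * pi * real (i + 1) / real k - 2 * pi * real r / real k = pi * (real (2 * (i + 1 - r)) / real k)"
    using assms by (simp add: of_nat_diff field_simps)
  moreover have "pi * (real (2 * (i + 1 - r)) / real k) \<le> pi * 1"
    using assms k by (intro mult_left_mono) (auto simp: divide_simps)
  ultimately have "sin (\<theta> - 2 * pi * real r / real k) > 0"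
    using t by (intro sin_gt_zero) linarith+
  then show ?thesis using o[of r] \<rho> by (metis diff_gt_0_iff_gt mult_pos_pos)
qed

text \<open>
  The same on the right side of the line. The sectors there have either an index whose angle
  is larger by at least \<open>\<pi>\<close> or, as indices start again at ray \<open>0\<close>, a smaller one.
\<close>

lemma offset_greater_sector:
  assumes "q \<in> sector k i p" "i < k" "k \<le> 2 * (i - r)"
  shows "offset k r q < offset k r p"
proof -
  obtain \<rho> \<theta> where \<rho>: "\<rho> > 0" and t: "2 * pi * real i / real k < \<theta>" "\<theta> < 2 * pi * real (i + 1) / real k"
    and o: "\<And>r. offset k r q - offset k r p = \<rho> * sin (\<theta> - 2 * pi * real r / real k)"
    using sector_offset[OF assms(1)] by metis
  have k: "real k > 0" using assms by simp
  have "2 * pi * real (i + 1) / real k \<le> 2 * pi * 1" "0 \<le> 2 * pi * real r / real k"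
    using assms k by (auto simp: divide_simps)
  moreover have "2 * pi * real i / real k - 2 * pi * real r / real k = pi * (real (2 * (i - r)) / real k)"
    using assms by (simp add: of_nat_diff field_simps)
  moreover have "pi * 1 \<le> pi * (real (2 * (i - r)) / real k)"
    using assms k by (intro mult_left_mono) (auto simp: divide_simps)
  ultimately have "sin (\<theta> - 2 * pi * real r / real k) < 0"
    using t by (intro sin_lt_zero) linarith+
  then show ?thesis using o[of r] \<rho> by (metis diff_less_0_iff_less mult_pos_neg)
qed

lemma offset_greater_sector_low:
  assumes "q \<in> sector k i p" "i < r" "2 * r \<le> k"
  shows "offset k r q < offset k r p"
proof -
  obtain \<rho> \<theta> where \<rho>: "\<rho> > 0" and t: "2 * pi * real i / real k < \<theta>" "\<theta> < 2 * pi * real (i + 1) / real k"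
    and o: "\<And>r. offset k r q - offset k r p = \<rho> * sin (\<theta> - 2 * pi * real r / real k)"
    using sector_offset[OF assms(1)] by metis
  have k: "real k > 0" using assms by simp
  have "real (i + 1) \<le> real r" using assms by simp
  then have "2 * pi * real (i + 1) / real k \<le> 2 * pi * real r / real k"
    by (intro divide_right_mono mult_left_mono) auto
  moreover have "2 * pi * real r / real k = pi * (real (2 * r) / real k)" by simp
  moreover have "pi * (real (2 * r) / real k) \<le> pi * 1"
    using assms k by (intro mult_left_mono) (auto simp: divide_simps)
  moreover have "0 \<le> 2 * pi * real i / real k" by simp
  ultimately have "sin (2 * pi * real r / real k - \<theta>) > 0"
    using t by (intro sin_gt_zero) linarith+
  then have "sin (\<theta> - 2 * pi * real r / real k) < 0" by (metis minus_diff_eq neg_0_less_iff_less sin_minus)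
  then show ?thesis using o[of r] \<rho> by (metis diff_less_0_iff_less mult_pos_neg)
qed

text \<open>
  Points with equal offset span a line parallel to ray \<open>r\<close>, so one of them lies on that ray of
  the other.
\<close>

lemma inj_on_offset:
  assumes gp: "general_position k P" and r: "r < k"
  shows "inj_on (offset k r) P"
proof (rule inj_onI, rule ccontr)
  fix p q assume pq: "p \<in> P" "q \<in> P" "offset k r p = offset k r q" "p \<noteq> q"
  define c where "c = cis (2 * pi * real r / real k)"
  define t where "t = Re ((q - p) * cis (- (2 * pi * real r / real k)))"
  have "(q - p) * cis (- (2 * pi * real r / real k)) = of_real t"
    using pq(3) by (simp add: complex_eq_iff t_def offset_def algebra_simps)
  then have "(q - p) * (cis (- (2 * pi * real r / real k)) * c) = of_real t * c" by (simp add: mult.assoc)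
  then have e: "q = p + of_real t * c" by (simp add: c_def cis_mult algebra_simps)
  show False
  proof (cases "t \<ge> 0")
    case True
    then have "q \<in> bounding_ray k r p" using e unfolding bounding_ray_def c_def by blast
    then show False using gp pq r unfolding general_position_def by blast
  next
    case False
    then have "p = q + of_real (- t) * c" "- t \<ge> 0" using e by auto
    then have "p \<in> bounding_ray k r q" unfolding bounding_ray_def c_def by blast
    then show False using gp pq r unfolding general_position_def by metis
  qed
qed

text \<open>
  The coordinates of the growing box are the negative offset from ray \<open>0\<close>, and the offset from
  ray \<open>r\<close> with the sign for which Erdos and Szekeres provide a long increasing chain. The choice
  \<open>r = h div 2\<close> balances the savings in the two cases, namely \<open>h - r\<close> and \<open>r\<close>.
\<close>

lemma exists_order_few_edges:
  assumes fin: "finite P" and gp: "general_position k P" and k: "k \<ge> 2"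
  defines "h \<equiv> (k + 1) div 2"
  defines "r \<equiv> h div 2"
  shows "\<exists>ps\<in>orders_of P. \<exists>m. card P \<le> m\<^sup>2 \<and> card (ordered_yao_edges k ps) + r * m \<le> h * card P"
proof -
  let ?f = "offset k 0" and ?g = "offset k r"
  have rk: "r < k" "0 < k" using k by (auto simp: r_def h_def)
  have f: "inj_on ?f P" and g: "inj_on ?g P" using inj_on_offset[OF gp] rk by auto
  have f': "inj_on (\<lambda>x. - ?f x) P" and g': "inj_on (\<lambda>x. - ?g x) P"
    using f g by (auto simp: inj_on_def)
  obtain A where A: "A \<subseteq> P" "card P \<le> (card A)\<^sup>2"
    "increasing_on A (\<lambda>x. - ?f x) ?g \<or> increasing_on A (\<lambda>x. - ?f x) (\<lambda>x. - ?g x)"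
    using erdos_szekeres[OF fin f' g] by blast
  \<comment> \<open>The upper half plane meets only the first \<open>h\<close> sectors.\<close>
  have U: "seen_sectors k ps p \<subseteq> {..<h}" if "\<And>q. precedes ps q p \<Longrightarrow> - ?f q < - ?f p" for ps p
  proof
    fix i assume "i \<in> seen_sectors k ps p"
    then obtain q where q: "i < k" "q \<in> sector k i p" "precedes ps q p" by (auto simp: seen_sectors_def)
    then show "i \<in> {..<h}" using that[OF q(3)] offset_greater_sector[of q k i p 0] by (force simp: h_def)
  qed
  \<comment> \<open>The half plane to the right of ray \<open>r\<close> avoids the sectors entirely to its left; for odd \<open>k\<close> the line cuts one sector, which may be seen.\<close>
  have V1: "seen_sectors k ps p \<subseteq> {..<k} - {r..<r + k div 2}" if "\<And>q. precedes ps q p \<Longrightarrow> ?g q < ?g p" for ps p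
  proof
    fix i assume "i \<in> seen_sectors k ps p"
    then obtain q where q: "i < k" "q \<in> sector k i p" "precedes ps q p" by (auto simp: seen_sectors_def)
    have "\<not> (r \<le> i \<and> 2 * (i + 1 - r) \<le> k)" using that[OF q(3)] offset_less_sector[of q k i p r] q by force
    then show "i \<in> {..<k} - {r..<r + k div 2}" using q(1) by auto
  qed
  \<comment> \<open>The half plane to the left of ray \<open>r\<close> meets only the next \<open>h\<close> sectors.\<close>
  have V2: "seen_sectors k ps p \<subseteq> {r..<r + h}" if "\<And>q. precedes ps q p \<Longrightarrow> - ?g q < - ?g p" for ps p
  proof
    fix i assume "i \<in> seen_sectors k ps p"
    then obtain q where q: "i < k" "q \<in> sector k i p" "precedes ps q p" by (auto simp: seen_sectors_def)
    have "\<not> k \<le> 2 * (i - r)" using that[OF q(3)] offset_greater_sector[of q k i p r] q by force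
    moreover have "\<not> (i < r \<and> 2 * r \<le> k)" using that[OF q(3)] offset_greater_sector_low[of q k i p r] q by force
    moreover have "2 * r \<le> k" using k by (auto simp: r_def h_def)
    ultimately show "i \<in> {r..<r + h}" using q(1) by (auto simp: h_def)
  qed
  have cV1: "card ({..<k} - {r..<r + k div 2}) = h"
  proof -
    have "{r..<r + k div 2} \<subseteq> {..<k}" using k by (auto simp: r_def h_def)
    then show ?thesis by (subst card_Diff_subset) (auto simp: h_def)
  qed
  have key: "\<exists>ps\<in>orders_of P. \<forall>p\<in>P. card (seen_sectors k ps p) + (if p \<in> A then r else 0) \<le> h"
    using A(3)
  proof
    assume inc: "increasing_on A (\<lambda>x. - ?f x) ?g"
    obtain ps where ps: "ps \<in> orders_of P" "\<And>p. p \<in> P \<Longrightarrow>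
       ((\<forall>q. precedes ps q p \<longrightarrow> - ?f q < - ?f p) \<or> (\<forall>q. precedes ps q p \<longrightarrow> ?g q < ?g p)) \<and>
       (p \<in> A \<longrightarrow> (\<forall>q. precedes ps q p \<longrightarrow> - ?f q < - ?f p \<and> ?g q < ?g p))"
      using exists_box_growing_order[OF fin f' g A(1) inc] by blast
    have "card (seen_sectors k ps p) + (if p \<in> A then r else 0) \<le> h" if p: "p \<in> P" for p
    proof (cases "p \<in> A")
      case True
      \<comment> \<open>Here the predecessors lie in the wedge from ray \<open>0\<close> to ray \<open>r\<close>.\<close>
      then have "seen_sectors k ps p \<subseteq> {..<h} \<inter> ({..<k} - {r..<r + k div 2})"
        using ps(2)[OF p] U[of ps p] V1[of ps p] by blast
      also have "\<dots> \<subseteq> {..<r}" using k by (auto simp: r_def h_def)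
      finally have "card (seen_sectors k ps p) \<le> r" by (metis card_lessThan card_mono finite_lessThan)
      then show ?thesis using True by (simp add: r_def)
    next
      case False
      have "card (seen_sectors k ps p) \<le> h"
        using ps(2)[OF p] card_mono[OF _ U[of ps p]] card_mono[OF _ V1[of ps p]] cV1 by auto
      then show ?thesis using False by simp
    qed
    then show ?thesis using ps(1) by blast
  next
    assume inc: "increasing_on A (\<lambda>x. - ?f x) (\<lambda>x. - ?g x)"
    obtain ps where ps: "ps \<in> orders_of P" "\<And>p. p \<in> P \<Longrightarrow>
       ((\<forall>q. precedes ps q p \<longrightarrow> - ?f q < - ?f p) \<or> (\<forall>q. precedes ps q p \<longrightarrow> - ?g q < - ?g p)) \<and>
       (p \<in> A \<longrightarrow> (\<forall>q. precedes ps q p \<longrightarrow> - ?f q < - ?f p \<and> - ?g q < - ?g p))"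
      using exists_box_growing_order[OF fin f' g' A(1) inc] by blast
    have "card (seen_sectors k ps p) + (if p \<in> A then r else 0) \<le> h" if p: "p \<in> P" for p
    proof (cases "p \<in> A")
      case True
      \<comment> \<open>Here they lie in the complementary wedge of the upper half plane.\<close>
      then have "seen_sectors k ps p \<subseteq> {..<h} \<inter> {r..<r + h}"
        using ps(2)[OF p] U[of ps p] V2[of ps p] by blast
      also have "\<dots> = {r..<h}" by auto
      finally have "card (seen_sectors k ps p) \<le> h - r" by (metis card_atLeastLessThan card_mono finite_atLeastLessThan)
      then show ?thesis using True by (simp add: r_def)
    next
      case False
      have "card (seen_sectors k ps p) \<le> h"
        using ps(2)[OF p] card_mono[OF _ U[of ps p]] card_mono[OF _ V2[of ps p]] by auto
      then show ?thesis using False by simp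
    qed
    then show ?thesis using ps(1) by blast
  qed
  then obtain ps where ps: "ps \<in> orders_of P"
    "\<And>p. p \<in> P \<Longrightarrow> card (seen_sectors k ps p) + (if p \<in> A then r else 0) \<le> h" by blast
  have st: "distinct ps" "set ps = P" using ps by (auto simp: orders_of_def)
  have "(\<Sum>p\<in>P. if p \<in> A then r else 0) = r * card A"
    using fin A(1) by (simp add: sum.If_cases Int_absorb1)
  then have "card (ordered_yao_edges k ps) + r * card A =
      (\<Sum>p\<in>P. card (seen_sectors k ps p) + (if p \<in> A then r else 0))"
    using card_ordered_yao_edges[of ps k] st gp by (simp add: sum.distrib)
  also have "\<dots> \<le> (\<Sum>p\<in>P. h)" by (intro sum_mono ps(2))
  also have "\<dots> = h * card P" by simp
  finally show ?thesis using ps(1) A(2) by blast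
qed

section \<open>Points in general position\<close>

lemma offset_diff: "offset k r (p - q) = offset k r p - offset k r q"
  by (simp add: offset_def left_diff_distrib)

lemma offset_add: "offset k r (p + q) = offset k r p + offset k r q"
  by (simp add: offset_def distrib_right)

lemma offset_eq_inner:
  "offset k r p = (\<i> * cis (2 * pi * real r / real k)) \<bullet> p"
  by (simp add: offset_def inner_complex_def)

lemma offset_bounding_ray: "q \<in> bounding_ray k r p \<Longrightarrow> offset k r q = offset k r p"
proof -
  assume "q \<in> bounding_ray k r p"
  then obtain t where "q = p + of_real t * cis (2 * pi * real r / real k)" by (auto simp: bounding_ray_def)
  then have "q - p = of_real t * cis (2 * pi * real r / real k)" by simp
  then have "offset k r (q - p) = 0" by (simp add: offset_def mult.assoc cis_mult)
  then show ?thesis by (simp add: offset_diff)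
qed

lemma negligible_equidistant:
  fixes p q :: "'a::euclidean_space"
  assumes "p \<noteq> q"
  shows "negligible {w. dist w p = dist w q}"
proof -
  have "dist w p = dist w q \<longleftrightarrow> (2 *\<^sub>R (q - p)) \<bullet> w = q \<bullet> q - p \<bullet> p" for w
  proof -
    have "dist w p = dist w q \<longleftrightarrow> (w - p) \<bullet> (w - p) = (w - q) \<bullet> (w - q)"
      by (simp add: dist_norm norm_eq_sqrt_inner)
    then show ?thesis by (simp add: inner_diff_left inner_diff_right inner_commute algebra_simps)
  qed
  then show ?thesis using negligible_hyperplane[of "2 *\<^sub>R (q - p)" "q \<bullet> q - p \<bullet> p"] assms by simp
qed

lemma negligible_finite_UN:
  "finite A \<Longrightarrow> (\<And>a. a \<in> A \<Longrightarrow> negligible (f a)) \<Longrightarrow> negligible (\<Union>a\<in>A. f a)"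
  by (rule negligible_Union) auto

text \<open>
  The positions excluded for a new point form a null set: finitely many lines parallel to the rays,
  circles around old points through old points, and perpendicular bisectors of old points.
\<close>

lemma exists_general_position_insert:
  assumes fin: "finite P" and gp: "general_position k P" and S: "open S" "S \<noteq> {}"
  shows "\<exists>w\<in>S. w \<notin> P \<and> general_position k (insert w P)"
proof -
  define bad where "bad = P \<union> (\<Union>p\<in>P. \<Union>i<k. {w. offset k i w = offset k i p}) \<union>
     (\<Union>p\<in>P. \<Union>q\<in>P. sphere p (dist p q)) \<union> (\<Union>p\<in>P. \<Union>q\<in>P - {p}. {w. dist w p = dist w q})"
  have "negligible {w. offset k i w = c}" for i c
    unfolding offset_eq_inner by (rule negligible_hyperplane) (simp add: cis_neq_zero)
  then have "negligible bad"
    unfolding bad_def using fin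
    by (intro negligible_Un negligible_finite_UN negligible_finite[OF fin] negligible_sphere negligible_equidistant) auto
  then have "\<not> S \<subseteq> bad" using open_not_negligible[OF S] negligible_subset by blast
  then obtain w where w: "w \<in> S" "w \<notin> bad" by blast
  have wP: "w \<notin> P" using w by (simp add: bad_def)
  have ray: "offset k i w \<noteq> offset k i p" if "p \<in> P" "i < k" for i p
    using w that by (auto simp: bad_def)
  have sph: "dist p w \<noteq> dist p q" if "p \<in> P" "q \<in> P" for p q
    using w that by (auto simp: bad_def)
  have bis: "dist w p \<noteq> dist w q" if "p \<in> P" "q \<in> P" "p \<noteq> q" for p q
    using w that by (auto simp: bad_def)
  have "q \<notin> bounding_ray k i p" if pq: "p \<in> insert w P" "q \<in> insert w P" "p \<noteq> q" "i < k" for p q i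
  proof
    assume b: "q \<in> bounding_ray k i p"
    then have "offset k i q = offset k i p" by (rule offset_bounding_ray)
    then have "p \<noteq> w" "q \<noteq> w" using pq ray[of q i] ray[of p i] by auto
    then show False using gp b pq unfolding general_position_def by blast
  qed
  moreover have "\<not> dist p q = dist p q'"
    if pq: "p \<in> insert w P" "q \<in> insert w P" "q' \<in> insert w P" "p \<noteq> q" "p \<noteq> q'" "q \<noteq> q'"
      "i < k" "q \<in> sector k i p" "q' \<in> sector k i p" for p q q' i
  proof (cases "p = w \<or> q = w \<or> q' = w")
    case True
    then show ?thesis
      using pq(1-6) bis[of q q'] sph[of p q] sph[of p q'] by (elim disjE) (simp, metis insert_iff, metis insert_iff)
  next
    case False
    then show ?thesis using general_position_dist_neq[OF gp, of p q q' i] pq by simp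
  qed
  ultimately have "general_position k (insert w P)"
    unfolding general_position_def by blast
  then show ?thesis using w wP by blast
qed

lemma exists_general_position_perturbation:
  assumes "finite I" and e: "\<epsilon> > 0"
  shows "\<exists>z. inj_on z I \<and> general_position k (z ` I) \<and> (\<forall>i\<in>I. dist (z i) (c i) < \<epsilon>)"
  using assms(1)
proof (induction I rule: finite_induct)
  case empty
  then show ?case by (simp add: general_position_def)
next
  case (insert x I)
  then obtain z where z: "inj_on z I" "general_position k (z ` I)" "\<And>i. i \<in> I \<Longrightarrow> dist (z i) (c i) < \<epsilon>" by blast
  have "ball (c x) \<epsilon> \<noteq> {}" using e by simp
  then obtain w where w: "w \<in> ball (c x) \<epsilon>" "w \<notin> z ` I" "general_position k (insert w (z ` I))"
    using exists_general_position_insert[OF _ z(2) open_ball] insert(1) by blast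
  have same: "(z(x := w)) ` I = z ` I" using insert(2) by auto
  have "inj_on (z(x := w)) (insert x I)"
    using z(1) w(2) insert(2) same by (simp add: inj_on_insert inj_on_fun_updI)
  moreover have "general_position k ((z(x := w)) ` insert x I)" using w(3) by (simp only: image_insert same fun_upd_same)
  moreover have "\<forall>i\<in>insert x I. dist ((z(x := w)) i) (c i) < \<epsilon>"
    using z(3) w(1) by (simp add: dist_commute)
  ultimately show ?case by blast
qed

section \<open>Facing sectors in a regular polygon\<close>

text \<open>
  For \<open>k \<ge> 2\<close> a sector is convex and is the intersection of the two half planes at its
  bounding rays. In this form membership is easy to establish under perturbation, since
  \<^const>\<open>offset\<close> is linear.
\<close>

lemma sector_if_offset:
  assumes k: "k \<ge> 2" and 1: "offset k i p < offset k i q" and 2: "offset k (i + 1) q < offset k (i + 1) p"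
  shows "q \<in> sector k i p"
proof -
  define \<alpha> where "\<alpha> = 2 * pi * real i / real k"
  define W where "W = (q - p) * cis (- \<alpha>)"
  define \<theta> where "\<theta> = Arg2pi W"
  have "Im W = offset k i q - offset k i p"
    unfolding W_def \<alpha>_def offset_def by (simp add: left_diff_distrib)
  then have ImW: "Im W > 0" using 1 by simp
  then have \<theta>: "0 < \<theta>" "\<theta> < pi" using Arg2pi_lt_pi[of W] by (auto simp: \<theta>_def)
  have W: "W = of_real (norm W) * cis \<theta>" unfolding \<theta>_def using Arg2pi_eq[of W] by (simp add: cis_conv_exp)
  have W0: "norm W > 0" using ImW by auto
  have "W * cis \<alpha> = q - p" by (simp add: W_def mult.assoc cis_mult)
  then have qp: "q - p = of_real (norm W) * cis (\<theta> + \<alpha>)" using W by (metis cis_mult mult.assoc)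
  have "offset k (i + 1) q - offset k (i + 1) p = Im (of_real (norm W) * cis (\<theta> + \<alpha>) * cis (- (2 * pi * real (i + 1) / real k)))"
    unfolding qp[symmetric] offset_def by (simp add: left_diff_distrib)
  also have "\<dots> = norm W * sin (\<theta> + \<alpha> - 2 * pi * real (i + 1) / real k)"
    by (simp add: mult.assoc cis_mult)
  also have "\<theta> + \<alpha> - 2 * pi * real (i + 1) / real k = \<theta> - 2 * pi / real k"
    by (simp add: \<alpha>_def add_divide_distrib distrib_left)
  finally have "norm W * sin (\<theta> - 2 * pi / real k) < 0" using 2 by simp
  then have s: "sin (\<theta> - 2 * pi / real k) < 0" using W0 by (simp add: mult_less_0_iff)
  have "\<theta> < 2 * pi / real k"
  proof (rule ccontr)
    assume "\<not> ?thesis"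
    moreover have "2 * pi / real k > 0" using k by simp
    ultimately have "sin (\<theta> - 2 * pi / real k) \<ge> 0" using \<theta> by (intro sin_ge_zero) linarith+
    then show False using s by simp
  qed
  moreover have "2 * pi * real (i + 1) / real k = \<alpha> + 2 * pi / real k"
    by (simp add: \<alpha>_def add_divide_distrib distrib_left)
  ultimately have "\<theta> + \<alpha> < 2 * pi * real (i + 1) / real k" "2 * pi * real i / real k < \<theta> + \<alpha>"
    using \<theta> by (auto simp: \<alpha>_def)
  moreover have "q = p + of_real (norm W) * cis (\<theta> + \<alpha>)" using qp by (simp add: algebra_simps)
  ultimately show ?thesis unfolding sector_def using W0 by blast
qed

text \<open>
  The vertices of a regular \<open>k\<close>-gon of circumradius \<open>6 k\<close> around the origin. The angle
  \<open>\<pi> (2 m + 1) / k\<close> is that of the bisector of sector \<open>m\<close>, so this bisector at vertex \<open>m\<close> passes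
  through the centre.
\<close>

definition polygon :: "nat \<Rightarrow> nat \<Rightarrow> complex" where
  "polygon k m = - (of_real (6 * real k) * cis (pi * (2 * real m + 1) / real k))"

lemma polygon_period: "k > 0 \<Longrightarrow> polygon k (m + k) = polygon k m"
proof -
  assume "k > 0"
  then have "cis (pi * (2 * real (m + k) + 1) / real k) = cis (pi * (2 * real m + 1) / real k + 2 * pi)"
    by (simp add: field_simps)
  also have "\<dots> = cis (pi * (2 * real m + 1) / real k)" by (simp only: cis_mult[symmetric]) (simp add: complex_eq_iff)
  finally show ?thesis by (simp add: polygon_def)
qed

lemma offset_polygon:
  "offset k i (polygon k m) = - (6 * real k * sin (pi * (2 * (real m - real i) + 1) / real k))"
proof -
  have "polygon k m * cis (- (2 * pi * real i / real k)) =
     - (of_real (6 * real k) * cis (pi * (2 * real m + 1) / real k + - (2 * pi * real i / real k)))"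
    by (simp only: polygon_def cis_mult[symmetric] minus_mult_left mult.assoc)
  moreover have "pi * (2 * real m + 1) / real k + - (2 * pi * real i / real k) = pi * (2 * (real m - real i) + 1) / real k"
    by (cases "k = 0") (auto simp: field_simps)
  ultimately show ?thesis by (simp add: offset_def)
qed

text \<open>
  A crude bound is enough: it guarantees that the margin \<open>6 k sin (\<pi>/k)\<close> below stays above an
  absolute constant.
\<close>

lemma sin_ge_third:
  assumes "0 \<le> x" "x \<le> pi / 2"
  shows "x / 3 \<le> sin (x::real)"
proof -
  have "\<bar>sin x - (\<Sum>m<3. sin_coeff m * x ^ m)\<bar> \<le> inverse (fact 3) * \<bar>x\<bar> ^ 3"
    by (rule Maclaurin_sin_bound)
  then have "\<bar>sin x - x\<bar> \<le> x ^ 3 / 6" using assms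
    by (simp add: sin_coeff_def numeral_eq_Suc fact_numeral)
  then have "x - x ^ 3 / 6 \<le> sin x" by linarith
  moreover have "x ^ 3 \<le> 4 * x"
  proof -
    have "x\<^sup>2 \<le> 2\<^sup>2" using assms pi_less_4 by (intro power_mono) auto
    then have "x * x\<^sup>2 \<le> x * 4" using assms by (intro mult_left_mono) auto
    then show ?thesis by (simp add: power2_eq_square power3_eq_cube mult.assoc)
  qed
  ultimately show ?thesis by simp
qed

text \<open>
  For the exact polygon each of the four offset differences has absolute value \<open>6 k\<close> times the sum
  of \<open>sin (\<pi>/k)\<close> and \<open>|sin (\<pi> (2 d + 1)/k)|\<close> or \<open>|sin (\<pi> (2 d - 1)/k)|\<close>. With \<open>d = k div 2\<close> the latter
  two sines have the required signs for both parities of \<open>k\<close>, because \<open>2 d - 1 \<le> k \<le> 2 d + 1\<close>. The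
  margin \<open>6 k sin (\<pi>/k) \<ge> 2 \<pi> > 6\<close> absorbs a displacement of both points by less than \<open>3\<close>.
\<close>

lemma polygon_mutual_sectors:
  assumes k: "k \<ge> 2" and d: "d = k div 2"
    and p: "norm (p - (c + polygon k m)) < 3" and q: "norm (q - (c + polygon k (m + d))) < 3"
  shows "q \<in> sector k m p" "p \<in> sector k (m + d) q"
proof -
  define s where "s = 6 * real k * sin (pi / real k)"
  have k0: "real k > 0" using k by simp
  have "pi / real k \<le> pi / 2" using k by (intro divide_left_mono) auto
  then have "pi / real k / 3 \<le> sin (pi / real k)" by (intro sin_ge_third) auto
  then have "6 * real k * (pi / real k / 3) \<le> s" unfolding s_def by (intro mult_left_mono) auto
  then have s: "s \<ge> 6" using k0 pi_gt3 by simp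
  define e where "e = (q - (c + polygon k (m + d))) - (p - (c + polygon k m))"
  have "norm e < 6" 
    unfolding e_def using norm_triangle_ineq4[of "q - (c + polygon k (m + d))" "p - (c + polygon k m)"] p q
    by linarith
  have err: "\<bar>offset k i e\<bar> < s" for i
  proof -
    have "\<bar>offset k i e\<bar> \<le> norm (e * cis (- (2 * pi * real i / real k)))"
      unfolding offset_def by (rule abs_Im_le_cmod)
    also have "\<dots> = norm e" by (simp add: norm_mult)
    finally show ?thesis using \<open>norm e < 6\<close> s by linarith
  qed
  have qp: "offset k i q - offset k i p =
     offset k i (polygon k (m + d)) - offset k i (polygon k m) + offset k i e" for i
  proof -
    have "q - p = (polygon k (m + d) - polygon k m) + e" by (simp add: e_def)
    then have "offset k i (q - p) = offset k i ((polygon k (m + d) - polygon k m) + e)" by simp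
    then show ?thesis by (simp add: offset_diff offset_add)
  qed
  have "k \<le> 2 * d + 1" "2 * d + 1 < 2 * k" "1 \<le> 2 * d" "2 * d \<le> k" using k d by auto
  then have D: "real k \<le> 2 * real d + 1" "2 * real d + 1 < 2 * real k" "1 \<le> 2 * real d" "2 * real d \<le> real k"
    by linarith+
  have hi: "6 * real k * sin (pi * (2 * real d + 1) / real k) \<le> 0"
  proof -
    have "pi \<le> pi * (2 * real d + 1) / real k" "pi * (2 * real d + 1) / real k < 2 * pi"
      using D k0 by (auto simp: divide_simps)
    then have "sin (pi * (2 * real d + 1) / real k) \<le> 0" by (rule sin_le_zero)
    then show ?thesis using k0 by (simp add: mult_le_0_iff)
  qed
  have lo: "6 * real k * sin (pi * (2 * real d - 1) / real k) \<ge> 0"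
  proof -
    have "0 \<le> pi * (2 * real d - 1) / real k" "pi * (2 * real d - 1) / real k \<le> pi"
      using D k0 by (auto simp: divide_simps)
    then have "sin (pi * (2 * real d - 1) / real k) \<ge> 0" by (rule sin_ge_zero)
    then show ?thesis using k0 by simp
  qed
  have neg: "sin (pi * (- x) / real k) = - sin (pi * x / real k)" for x by simp
  have "offset k m p < offset k m q"
    using qp[of m] err[of m] hi unfolding offset_polygon by (simp add: s_def)
  moreover have "offset k (m + 1) q < offset k (m + 1) p"
    using qp[of "m + 1"] err[of "m + 1"] lo neg[of 1] unfolding offset_polygon by (simp add: s_def algebra_simps)
  ultimately show "q \<in> sector k m p" by (intro sector_if_offset k)
  have "offset k (m + d) q < offset k (m + d) p"
    using qp[of "m + d"] err[of "m + d"] lo neg[of "2 * real d - 1"] unfolding offset_polygon by (simp add: s_def algebra_simps)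
  moreover have "offset k (m + d + 1) p < offset k (m + d + 1) q"
    using qp[of "m + d + 1"] err[of "m + d + 1"] hi neg[of 1] neg[of "2 * real d + 1"]
    unfolding offset_polygon by (simp add: s_def algebra_simps)
  ultimately show "p \<in> sector k (m + d) q" by (intro sector_if_offset k)
qed

lemma sector_period: "k > 0 \<Longrightarrow> sector k (i + k) p = sector k i p"
proof -
  assume "k > 0"
  then have shift: "2 * pi * real (i + k + j) / real k = 2 * pi * real (i + j) / real k + 2 * pi" for j
    by (simp add: field_simps)
  have "(\<exists>r \<theta>. x = p + of_real r * cis \<theta> \<and> r > 0 \<and> a + 2 * pi < \<theta> \<and> \<theta> < b + 2 * pi) \<longleftrightarrow>
        (\<exists>r \<theta>. x = p + of_real r * cis \<theta> \<and> r > 0 \<and> a < \<theta> \<and> \<theta> < b)" for x a b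
  proof safe
    fix r \<theta> assume "r > 0" "a + 2 * pi < \<theta>" "\<theta> < b + 2 * pi" "x = p + of_real r * cis \<theta>"
    moreover have "cis (\<theta> - 2 * pi) = cis \<theta>" by (simp add: complex_eq_iff sin_diff cos_diff)
    ultimately show "\<exists>r' \<theta>'. p + of_real r * cis \<theta> = p + of_real r' * cis \<theta>' \<and> r' > 0 \<and> a < \<theta>' \<and> \<theta>' < b"
      by (intro exI[of _ r] exI[of _ "\<theta> - 2 * pi"]) auto
  next
    fix r \<theta> assume "r > 0" "a < \<theta>" "\<theta> < b" "x = p + of_real r * cis \<theta>"
    moreover have "cis (\<theta> + 2 * pi) = cis \<theta>" by (simp add: complex_eq_iff)
    ultimately show "\<exists>r' \<theta>'. p + of_real r * cis \<theta> = p + of_real r' * cis \<theta>' \<and> r' > 0 \<and> a + 2 * pi < \<theta>' \<and> \<theta>' < b + 2 * pi"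
      by (intro exI[of _ r] exI[of _ "\<theta> + 2 * pi"]) auto
  qed
  then show ?thesis
    unfolding sector_def using shift[of 0] shift[of 1] by (simp only: add_0_right)
qed

text \<open>
  The pigeonhole step of the lower bound: \<open>X\<close> collects the vertices that do not see the sector facing
  the centre, and it is disjoint from its cyclic shift by \<open>d\<close>.
\<close>

lemma card_seen_polygon:
  assumes k: "k \<ge> 2" and ps: "distinct ps"
    and W: "\<And>m. m < k \<Longrightarrow> W m \<in> set ps" "\<And>m. m < k \<Longrightarrow> norm (W m - (c + polygon k m)) < 3"
  shows "(k + 1) div 2 \<le> card {m. m < k \<and> m \<in> seen_sectors k ps (W m)}"
proof -
  define d where "d = k div 2"
  define X where "X = {m. m < k \<and> m \<notin> seen_sectors k ps (W m)}"
  have k0: "k > 0" using k by simp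
  have disj: "X \<inter> (\<lambda>m. (m + d) mod k) ` X = {}"
  proof (rule ccontr)
    assume "\<not> ?thesis"
    then obtain m where m: "m \<in> X" "(m + d) mod k \<in> X" by blast
    define l where "l = (m + d) mod k"
    have lk: "l < k" "m < k" using m k0 by (auto simp: l_def X_def)
    have "d < k" using k by (simp add: d_def)
    then have "m + d = l \<or> m + d = l + k" using lk by (auto simp: l_def mod_if)
    then have per: "polygon k (m + d) = polygon k l" "sector k (m + d) q = sector k l q" for q
      using polygon_period[OF k0] sector_period[OF k0] by auto
    have "W l \<in> sector k m (W m)" "W m \<in> sector k l (W l)"
      using polygon_mutual_sectors[OF k d_def W(2)[OF lk(2)], of "W l"] W(2)[OF lk(1)] by (auto simp: per)
    moreover from this(1) have "W l \<noteq> W m" using sector_iff_Arg2pi[OF lk(2)] by blast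
    then have "precedes ps (W l) (W m) \<or> precedes ps (W m) (W l)"
      using precedes_total W(1) lk by metis
    ultimately have "m \<in> seen_sectors k ps (W m) \<or> l \<in> seen_sectors k ps (W l)"
      using lk by (auto simp: seen_sectors_def)
    then show False using m by (auto simp: X_def l_def)
  qed
  have "inj_on (\<lambda>m. (m + d) mod k) X"
  proof (rule inj_onI)
    fix a b assume ab: "a \<in> X" "b \<in> X" "(a + d) mod k = (b + d) mod k"
    then have "a mod k = b mod k" by (simp add: nat_mod_eq_iff)
    then show "a = b" using ab by (simp add: X_def)
  qed
  then have "card ((\<lambda>m. (m + d) mod k) ` X) = card X" by (rule card_image)
  moreover have "finite X" by (simp add: X_def)
  moreover have "card (X \<union> (\<lambda>m. (m + d) mod k) ` X) \<le> card {..<k}"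
    using k0 by (intro card_mono) (auto simp: X_def)
  ultimately have X: "2 * card X \<le> k" using disj by (simp add: card_Un_disjoint)
  have "{m. m < k \<and> m \<in> seen_sectors k ps (W m)} = {..<k} - X" by (auto simp: X_def)
  moreover have "card ({..<k} - X) = k - card X" by (subst card_Diff_subset) (auto simp: X_def)
  moreover have "(k + 1) div 2 \<le> k - card X" using X by presburger
  ultimately show ?thesis by simp
qed

section \<open>Point sets with many edges under every order\<close>

text \<open>
  Only a full \<open>N \<times> N\<close> block of the grid matters; the remaining \<open>n - N\<^sup>2\<close> points may lie anywhere
  in general position. A centre is admissible if it is at distance at least \<open>6 k\<close> from the
  boundary of the block, since then the rounded vertices stay in the block.
\<close>

lemma exists_point_set_many_edges:
  assumes k: "k \<ge> 2" and N: "N\<^sup>2 \<le> n"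
  shows "\<exists>P. finite P \<and> card P = n \<and> general_position k P \<and>
    (\<forall>ps\<in>orders_of P. (k + 1) div 2 * (N - 12 * k)\<^sup>2 \<le> card (ordered_yao_edges k ps))"
proof -
  define Q where "Q = {0..<int N} \<times> {0..<int N}"
  have Q: "finite Q" "card Q \<le> n" using N by (simp_all add: Q_def card_cartesian_product power2_eq_square)
  have "infinite (UNIV - Q)" using Q(1) by (simp add: Diff_infinite_finite infinite_UNIV_char_0 finite_prod)
  then obtain B where B: "finite B" "card B = n - card Q" "B \<subseteq> UNIV - Q"
    using infinite_arbitrarily_large by blast
  define I where "I = Q \<union> B"
  have "Q \<inter> B = {}" using B(3) by blast
  then have I: "finite I" "card I = n" "Q \<subseteq> I"
    using Q B by (simp_all add: I_def card_Un_disjoint)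
  define corner where "corner = (\<lambda>a. Complex (of_int (fst a)) (of_int (snd a)))"
  obtain z where z: "inj_on z I" "general_position k (z ` I)" "\<And>a. a \<in> I \<Longrightarrow> dist (z a) (corner a) < 1"
    using exists_general_position_perturbation[OF I(1), of 1 k corner] by auto
  define cell where "cell = (\<lambda>c m. (fst c + \<lfloor>Re (polygon k m)\<rfloor>, snd c + \<lfloor>Im (polygon k m)\<rfloor>))"
  define G where "G = {6 * int k..<int N - 6 * int k} \<times> {6 * int k..<int N - 6 * int k}"
  have cardG: "card G = (N - 12 * k)\<^sup>2"
  proof -
    have "nat (int N - 6 * int k - 6 * int k) = N - 12 * k" by simp
    then show ?thesis unfolding G_def by (simp add: card_cartesian_product power2_eq_square)
  qed
  have cell_in: "cell c m \<in> I" if "c \<in> G" for c m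
  proof -
    have nrm: "norm (polygon k m) = 6 * real k" by (simp add: polygon_def norm_mult)
    have fl: "- (6 * int k) \<le> \<lfloor>x\<rfloor> \<and> \<lfloor>x\<rfloor> \<le> 6 * int k" if "\<bar>x\<bar> \<le> 6 * real k" for x
    proof
      show "- (6 * int k) \<le> \<lfloor>x\<rfloor>" using that by (simp add: le_floor_iff)
      have "of_int \<lfloor>x\<rfloor> \<le> x" by simp
      also have "x \<le> of_int (6 * int k)" using that by simp
      finally show "\<lfloor>x\<rfloor> \<le> 6 * int k" by (simp only: of_int_le_iff)
    qed
    have "cell c m \<in> Q"
      using that fl[of "Re (polygon k m)"] fl[of "Im (polygon k m)"]
        abs_Re_le_cmod[of "polygon k m"] abs_Im_le_cmod[of "polygon k m"] nrm
      by (auto simp: cell_def Q_def G_def)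
    then show ?thesis using I by blast
  qed
  \<comment> \<open>Rounding down moves a vertex by at most \<open>2\<close>, the perturbation of the grid by less than \<open>1\<close>.\<close>
  have near: "norm (z (cell c m) - (corner c + polygon k m)) < 3" if "c \<in> G" for c m
  proof -
    have "norm (corner (cell c m) - (corner c + polygon k m)) \<le>
       \<bar>Re (corner (cell c m) - (corner c + polygon k m))\<bar> + \<bar>Im (corner (cell c m) - (corner c + polygon k m))\<bar>"
      by (rule cmod_le)
    also have "\<dots> \<le> 1 + 1"
      by (intro add_mono) (simp_all add: corner_def cell_def, linarith+)
    finally have "norm (corner (cell c m) - (corner c + polygon k m)) \<le> 2" by simp
    moreover have "norm (z (cell c m) - corner (cell c m)) < 1"
      using z(3)[OF cell_in[OF that]] by (simp add: dist_norm)
    ultimately show ?thesis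
      using norm_triangle_ineq[of "z (cell c m) - corner (cell c m)" "corner (cell c m) - (corner c + polygon k m)"]
      unfolding diff_add_cancel add_diff_eq by linarith
  qed
  have many: "(k + 1) div 2 * (N - 12 * k)\<^sup>2 \<le> card (ordered_yao_edges k ps)" if "ps \<in> orders_of (z ` I)" for ps
  proof -
    have ps: "distinct ps" "set ps = z ` I" using that by (auto simp: orders_of_def)
    let ?T = "\<lambda>c. {m. m < k \<and> m \<in> seen_sectors k ps (z (cell c m))}"
    let ?f = "\<lambda>(c, m). (z (cell c m), m)"
    have "(k + 1) div 2 \<le> card (?T c)" if "c \<in> G" for c
      by (rule card_seen_polygon[OF k ps(1), of _ "corner c"]) (use that cell_in near ps(2) in auto)
    then have "(\<Sum>c\<in>G. (k + 1) div 2) \<le> (\<Sum>c\<in>G. card (?T c))" by (intro sum_mono)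
    also have "\<dots> = card (Sigma G ?T)" by (subst card_SigmaI) (auto simp: G_def)
    also have "\<dots> = card (?f ` Sigma G ?T)"
    proof (rule card_image[symmetric], rule inj_onI)
      fix x y assume xy: "x \<in> Sigma G ?T" "y \<in> Sigma G ?T" "?f x = ?f y"
      obtain c m c' m' where s: "x = (c, m)" "y = (c', m')" by (cases x, cases y) blast
      have "c \<in> G" "c' \<in> G" "m = m'" "z (cell c m) = z (cell c' m)" using xy s by auto
      then have "cell c m = cell c' m" using inj_onD[OF z(1)] cell_in by blast
      then have "c = c'" by (simp add: cell_def prod_eq_iff)
      then show "x = y" using s \<open>m = m'\<close> by simp
    qed
    also have "\<dots> \<le> card (Sigma (z ` I) (seen_sectors k ps))"
      using I(1) cell_in by (intro card_mono finite_SigmaI) (auto simp: seen_sectors_def)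
    also have "\<dots> = card (ordered_yao_edges k ps)"
      using card_ordered_yao_edges[of ps k] ps z(2) I(1)
      by (subst card_SigmaI) (auto simp: seen_sectors_def)
    finally show ?thesis by (simp add: cardG mult.commute)
  qed
  have "finite (z ` I)" "card (z ` I) = n" using I z(1) by (simp_all add: card_image)
  then show ?thesis using z(2) many by blast
qed

section \<open>Asymptotics\<close>

text \<open>
  Each point set with the required property has the order of \<open>exists_order_few_edges\<close>, which bounds
  the admissible values from above.
\<close>

lemma yao_e_bounds:
  assumes k: "k \<ge> 2"
  defines "h \<equiv> (k + 1) div 2"
  shows yao_e_upper: "\<exists>m. n \<le> m\<^sup>2 \<and> yao_e k n + h div 2 * m \<le> h * n"
    and yao_e_lower: "N\<^sup>2 \<le> n \<Longrightarrow> h * (N - 12 * k)\<^sup>2 \<le> yao_e k n"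
proof -
  define Q where "Q m \<longleftrightarrow> (\<exists>P. finite P \<and> card P = n \<and> general_position k P \<and>
     (\<forall>ps \<in> orders_of P. m \<le> card (ordered_yao_edges k ps)))" for m
  have e: "yao_e k n = (GREATEST m. Q m)" by (simp add: yao_e_def Q_def)
  have up: "\<exists>m'. n \<le> m'\<^sup>2 \<and> m + h div 2 * m' \<le> h * n" if Qm: "Q m" for m
  proof -
    obtain P where P: "finite P" "card P = n" "general_position k P"
      "\<And>ps. ps \<in> orders_of P \<Longrightarrow> m \<le> card (ordered_yao_edges k ps)" using Qm unfolding Q_def by blast
    obtain ps m' where "ps \<in> orders_of P" "n \<le> m'\<^sup>2"
      "card (ordered_yao_edges k ps) + h div 2 * m' \<le> h * n"
      using exists_order_few_edges[OF P(1,3) k] P(2) unfolding h_def by blast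
    then show ?thesis using P(4) by (meson add_le_mono1 order_trans)
  qed
  then have bound: "m \<le> h * n" if "Q m" for m using that by fastforce
  have low: "Q (h * (N - 12 * k)\<^sup>2)" if "N\<^sup>2 \<le> n" for N
    using exists_point_set_many_edges[OF k that] unfolding Q_def h_def .
  \<comment> \<open>A greatest value exists because \<open>Q\<close> holds somewhere (here with an empty block) and is bounded.\<close>
  have "Q (h * (0 - 12 * k)\<^sup>2)" by (rule low) simp
  then have "Q (yao_e k n)" unfolding e using bound by (rule GreatestI_nat)
  then show "\<exists>m. n \<le> m\<^sup>2 \<and> yao_e k n + h div 2 * m \<le> h * n" by (rule up)
  show "h * (N - 12 * k)\<^sup>2 \<le> yao_e k n" if "N\<^sup>2 \<le> n"
    unfolding e using low[OF that] bound by (rule Greatest_le_nat)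
qed

lemma ceiling_half: "of_int \<lceil>real k / 2\<rceil> = real ((k + 1) div 2)"
proof -
  have "\<lceil>real k / 2\<rceil> = int ((k + 1) div 2)"
    by (rule ceiling_unique) (auto simp: field_simps)
  then show ?thesis by simp
qed

lemma yao_e_le:
  assumes "k \<ge> 2"
  shows "real (yao_e k n) \<le> real n * real ((k + 1) div 2) - real ((k + 1) div 2 div 2) * sqrt (real n)"
proof -
  obtain m where m: "n \<le> m\<^sup>2" "yao_e k n + (k + 1) div 2 div 2 * m \<le> (k + 1) div 2 * n"
    using yao_e_upper[OF assms] by blast
  have "sqrt (real n) \<le> real m" using m(1) by (intro real_le_lsqrt) (simp_all flip: of_nat_power)
  then have "real ((k + 1) div 2 div 2) * sqrt (real n) \<le> real ((k + 1) div 2 div 2) * real m"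
    by (intro mult_left_mono) auto
  moreover have "real (yao_e k n + (k + 1) div 2 div 2 * m) \<le> real ((k + 1) div 2 * n)"
    using m(2) by (simp only: of_nat_le_iff)
  ultimately show ?thesis by (simp add: mult.commute)
qed

lemma yao_e_ge:
  assumes k: "k \<ge> 2"
  shows "real n * real ((k + 1) div 2) - 26 * ((real k)\<^sup>2 * sqrt (real n)) \<le> real (yao_e k n)"
proof -
  define N where "N = nat \<lfloor>sqrt (real n)\<rfloor>"
  define h where "h = (k + 1) div 2"
  have N: "real N \<le> sqrt (real n)" "sqrt (real n) < real N + 1"
    unfolding N_def by (auto simp: of_nat_nat)
  have "(real N)\<^sup>2 \<le> real n" using power_mono[OF N(1), of 2] by simp
  then have "N\<^sup>2 \<le> n" by (simp flip: of_nat_power)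
  then have "h * (N - 12 * k)\<^sup>2 \<le> yao_e k n" unfolding h_def by (rule yao_e_lower[OF k])
  then have e: "real h * (real (N - 12 * k))\<^sup>2 \<le> real (yao_e k n)" by (simp flip: of_nat_power of_nat_mult)
  have "real n < (real N + 1)\<^sup>2" using power_strict_mono[OF N(2), of 2] by simp
  then have "real n < real ((N + 1)\<^sup>2)" by (simp add: add.commute)
  then have "n < (N + 1)\<^sup>2" by (simp only: of_nat_less_iff)
  then have "n \<le> N\<^sup>2 + 2 * N" by (simp add: power2_eq_square)
  then have "real n \<le> real (N\<^sup>2 + 2 * N)" by (simp only: of_nat_le_iff)
  then have n: "real n \<le> (real N)\<^sup>2 + 2 * real N" by simp
  have sq: "(real N)\<^sup>2 - 24 * real k * real N \<le> (real (N - 12 * k))\<^sup>2"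
  proof (cases "12 * k \<le> N")
    case True
    then show ?thesis by (simp add: of_nat_diff power2_eq_square algebra_simps)
  next
    case False
    then have "real N * real N \<le> real N * (24 * real k)" by (intro mult_left_mono) auto
    then show ?thesis using False by (simp add: power2_eq_square algebra_simps)
  qed
  have "h \<le> k" using k by (simp add: h_def)
  have "real n * real h \<le> real h * ((real N)\<^sup>2 + 2 * real N)"
    using mult_left_mono[OF n, of "real h"] by (simp add: mult.commute)
  also have "\<dots> = real h * ((real N)\<^sup>2 - 24 * real k * real N) + real h * (real N * (2 + 24 * real k))"
    by (simp add: algebra_simps)
  also have "\<dots> \<le> real h * (real (N - 12 * k))\<^sup>2 + real k * (sqrt (real n) * (26 * real k))"
    using k \<open>h \<le> k\<close> N(1) by (intro add_mono mult_left_mono[OF sq] mult_mono) auto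
  finally show ?thesis using e by (simp add: h_def power2_eq_square mult_ac)
qed

theorem theorem3:
  "(\<forall>k\<ge>2. (\<lambda>n. real n * of_int \<lceil>real k / 2\<rceil> - real (yao_e k n)) \<in> o(\<lambda>n. real n)) \<and>
   (\<exists>C c :: real. C > 0 \<and> c > 0 \<and>
      (\<forall>k\<ge>3. \<forall>\<^sub>F n in sequentially.
         real n * of_int \<lceil>real k / 2\<rceil> - C * (real k ^ 2 * sqrt (real n)) \<le> real (yao_e k n) \<and>
         real (yao_e k n) \<le> real n * of_int \<lceil>real k / 2\<rceil> - c * (real k * sqrt (real n))))"
proof (intro conjI allI impI exI)
  fix k :: nat assume k: "k \<ge> 2"
  have "(\<lambda>n. real n * of_int \<lceil>real k / 2\<rceil> - real (yao_e k n)) \<in> O(\<lambda>n. sqrt (real n))"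
  proof (rule bigoI[of _ "26 * (real k)\<^sup>2"], rule always_eventually, rule allI)
    fix n
    have "0 \<le> real ((k + 1) div 2 div 2) * sqrt (real n)" by simp
    then have "real (yao_e k n) \<le> real n * real ((k + 1) div 2)" using yao_e_le[OF k, of n] by linarith
    then show "norm (real n * of_int \<lceil>real k / 2\<rceil> - real (yao_e k n)) \<le> 26 * (real k)\<^sup>2 * norm (sqrt (real n))"
      using yao_e_ge[OF k, of n] by (simp add: ceiling_half)
  qed
  also have "(\<lambda>n. sqrt (real n)) \<in> o(\<lambda>n. real n)" by real_asymp
  finally show "(\<lambda>n. real n * of_int \<lceil>real k / 2\<rceil> - real (yao_e k n)) \<in> o(\<lambda>n. real n)" .
next
  fix k :: nat assume k: "k \<ge> 3"
  have c: "1 / 6 * real k \<le> real ((k + 1) div 2 div 2)"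
  proof -
    \<comment> \<open>The extreme ratio is attained at \<open>k = 6\<close>.\<close>
    have "k \<le> 6 * ((k + 1) div 2 div 2)" using k by presburger
    then have "real k \<le> real (6 * ((k + 1) div 2 div 2))" by (simp only: of_nat_le_iff)
    then show ?thesis by simp
  qed
  show "\<forall>\<^sub>F n in sequentially.
         real n * of_int \<lceil>real k / 2\<rceil> - 26 * (real k ^ 2 * sqrt (real n)) \<le> real (yao_e k n) \<and>
         real (yao_e k n) \<le> real n * of_int \<lceil>real k / 2\<rceil> - 1 / 6 * (real k * sqrt (real n))"
  proof (rule always_eventually, rule allI)
    fix n
    have "1 / 6 * (real k * sqrt (real n)) \<le> real ((k + 1) div 2 div 2) * sqrt (real n)"
      using mult_right_mono[OF c, of "sqrt (real n)"] by simp
    then show "real n * of_int \<lceil>real k / 2\<rceil> - 26 * (real k ^ 2 * sqrt (real n)) \<le> real (yao_e k n) \<and>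
         real (yao_e k n) \<le> real n * of_int \<lceil>real k / 2\<rceil> - 1 / 6 * (real k * sqrt (real n))"
      using yao_e_le[of k n] yao_e_ge[of k n] k by (simp add: ceiling_half)
  qed
qed simp_all

end
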